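(* Let $n\ge1$ and let $P$ be a complex polynomial of degree $n$ having all its zeros in $\{z\in\mathbb{C}:|z|\ge k\}$, where $k\ge 1$ is real; that is, $P(z)=\alpha_n\prod_{j=1}^n(z-b_j)=\alpha_0+\alpha_1z+\dots+\alpha_nz^n$, $\alpha_n\ne0$, $|b_j|\ge k\ge1$ for $j=1,\dots,n$. Then for every $z\in\mathbb{C}$ with $|z|=1$, $$|P'(z)|\le\frac12\left[n-\frac{2}{k+1}\left(\frac{n(k-1)}{2}+\frac{|\alpha_0|-k^n|\alpha_n|}{|\alpha_0|+k^n|\alpha_n|}\right)\frac{|P(z)|^2}{\{M(P,1)\}^2}\right]M(P,1).$$
   Context: $M(P,1)=\sup_{|z|=1}|P(z)|$. *)

theory Defs
  imports "HOL-Analysis.Analysis" "HOL-Computational_Algebra.Polynomial"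
begin

definition max_mod :: "complex poly \<Rightarrow> real \<Rightarrow> real" where
  "max_mod P r = (SUP z\<in>sphere 0 r. cmod (poly P z))"

end

theory Submission
  imports Defs "HOL-Complex_Analysis.Conformal_Mappings"
    "HOL-Computational_Algebra.Fundamental_Theorem_Algebra"
begin

text \<open>
  Let \<open>M = max_mod P 1\<close>. On the unit circle the reciprocal polynomial
  \<open>Q(z) = z\<^sup>n cnj (P (1 / cnj z))\<close> satisfies \<open>|Q'(z)| = |n P(z) - z P'(z)|\<close>, and only this last
  expression is used. If all zeros lie outside the open unit disc, summing
  \<open>Re (z / (z - b)) \<le> 1 / (1 + |b|)\<close> over the zeros gives
  \<open>|Q'(z)|\<^sup>2 - |P'(z)|\<^sup>2 \<ge> n |P(z)|\<^sup>2 S\<close> with \<open>S = \<Sum>(|b| - 1) / (|b| + 1)\<close>. Applying this (with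
  \<open>S \<ge> 0\<close>) to \<open>P - \<lambda>\<close>, \<open>|\<lambda>| > M\<close>, for a suitable argument of \<open>\<lambda>\<close> gives
  \<open>|P'(z)| + |Q'(z)| \<le> n M\<close>. Dividing, \<open>|Q'(z)| - |P'(z)| \<ge> |P(z)|\<^sup>2 S / M\<close>, so
  \<open>2 |P'(z)| \<le> n M - |P(z)|\<^sup>2 S / M\<close>. Finally \<open>S\<close> is bounded below because
  \<open>x \<mapsto> (x - 1) / (x + 1)\<close> is subadditive with respect to multiplication on \<open>[1, \<infinity>)\<close>
  (it is \<open>tanh (ln x / 2)\<close>).
\<close>

section \<open>Logarithmic derivative estimates on the unit circle\<close>

lemma Re_of_real_mult: "Re (of_real x * w) = x * Re w"
  by simp

text \<open>Cleared form of \<open>Re (z / (z - b)) \<le> 1 / (1 + cmod b)\<close>, which also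
  covers \<open>z = b\<close>. Multiplied out, it is
  \<open>(cmod b - 1) * (cmod b + r) \<ge> 0\<close> with \<open>r = Re (z * cnj b)\<close>.\<close>

lemma Re_mult_cnj_diff_le:
  fixes z b :: complex
  assumes "cmod z = 1" "cmod b \<ge> 1"
  shows "Re (z * cnj (z - b)) \<le> (cmod (z - b))\<^sup>2 / (1 + cmod b)"
proof -
  define r where "r = Re (z * cnj b)"
  have zz: "z * cnj z = 1"
    using assms(1) by (simp add: complex_norm_square[symmetric])
  have "\<bar>r\<bar> \<le> cmod (z * cnj b)"
    unfolding r_def by (rule abs_Re_le_cmod)
  hence r: "cmod b + r \<ge> 0"
    using assms(1) by (simp add: norm_mult)
  have Re_eq: "Re (z * cnj (z - b)) = 1 - r"
    using zz by (simp add: r_def algebra_simps)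
  have "(cmod (z - b))\<^sup>2 = (cmod z)\<^sup>2 + (cmod b)\<^sup>2 - 2 * r"
    unfolding r_def cmod_power2 by (simp add: power2_eq_square algebra_simps)
  hence sq: "(cmod (z - b))\<^sup>2 = 1 + (cmod b)\<^sup>2 - 2 * r"
    using assms(1) by simp
  have "(cmod b - 1) * (cmod b + r) \<ge> 0"
    using r assms(2) by simp
  hence "(1 - r) * (1 + cmod b) \<le> 1 + (cmod b)\<^sup>2 - 2 * r"
    by (simp add: power2_eq_square algebra_simps)
  thus ?thesis
    unfolding Re_eq sq using assms(2) by (subst pos_le_divide_eq) auto
qed

text \<open>This sums the previous bound over the linear factors of \<open>z P'(z) / P(z)\<close>.
  Multiplying by \<open>|P(z)|^2\<close> avoids a case distinction when \<open>z\<close> is itself a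
  zero.\<close>

lemma Re_cnj_pderiv_prod_mset_le:
  fixes z :: complex and A :: "complex multiset"
  assumes "cmod z = 1" "\<And>b. b \<in># A \<Longrightarrow> cmod b \<ge> 1"
  shows "Re (cnj (poly (\<Prod>b\<in>#A. [:-b, 1:]) z) * (z * poly (pderiv (\<Prod>b\<in>#A. [:-b, 1:])) z))
    \<le> (cmod (poly (\<Prod>b\<in>#A. [:-b, 1:]) z))\<^sup>2 * (\<Sum>b\<in>#A. 1 / (1 + cmod b))"
  using assms(2)
proof (induction A)
  case empty
  thus ?case by simp
next
  case (add b A)
  define R where "R = (\<Prod>b\<in>#A. [:-b, 1:])"
  define T where "T = (\<Sum>b\<in>#A. 1 / (1 + cmod b))"
  define p where "p = poly R z"
  define p' where "p' = poly (pderiv R) z"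
  have IH: "Re (cnj p * (z * p')) \<le> (cmod p)\<^sup>2 * T"
    using add.IH add.prems unfolding R_def T_def p_def p'_def by simp
  have b: "Re (z * cnj (z - b)) \<le> (cmod (z - b))\<^sup>2 / (1 + cmod b)"
    using add.prems by (intro Re_mult_cnj_diff_le assms(1)) auto
  \<comment> \<open>The product rule, arranged so that each summand is a squared modulus times a
    quantity already bounded, by \<open>b\<close> or by \<open>IH\<close>.\<close>
  have "cnj ((z - b) * p) * (z * (p + (z - b) * p'))
      = (p * cnj p) * (z * cnj (z - b)) + ((z - b) * cnj (z - b)) * (cnj p * (z * p'))"
    by (simp add: algebra_simps)
  also have "\<dots> = of_real ((cmod p)\<^sup>2) * (z * cnj (z - b))
      + of_real ((cmod (z - b))\<^sup>2) * (cnj p * (z * p'))"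
    by (simp only: complex_norm_square)
  finally have "Re (cnj ((z - b) * p) * (z * (p + (z - b) * p')))
      = (cmod p)\<^sup>2 * Re (z * cnj (z - b)) + (cmod (z - b))\<^sup>2 * Re (cnj p * (z * p'))"
    by (simp only: plus_complex.sel Re_of_real_mult)
  also have "\<dots> \<le> (cmod p)\<^sup>2 * ((cmod (z - b))\<^sup>2 / (1 + cmod b))
      + (cmod (z - b))\<^sup>2 * ((cmod p)\<^sup>2 * T)"
    by (intro add_mono mult_left_mono b IH) auto
  also have "\<dots> = (cmod ((z - b) * p))\<^sup>2 * (1 / (1 + cmod b) + T)"
    unfolding norm_mult power_mult_distrib by (simp add: algebra_simps)
  finally have "Re (cnj ((z - b) * p) * (z * (p + (z - b) * p')))
      \<le> (cmod ((z - b) * p))\<^sup>2 * (1 / (1 + cmod b) + T)" .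
  moreover have "(\<Prod>b\<in>#add_mset b A. [:-b, 1:]) = [:-b, 1:] * R"
    by (simp add: R_def)
  moreover have "poly ([:-b, 1:] * R) z = (z - b) * p"
    by (simp add: p_def algebra_simps)
  moreover have "poly (pderiv ([:-b, 1:] * R)) z = p + (z - b) * p'"
    by (simp only: pderiv_mult) (simp add: p_def p'_def pderiv_pCons algebra_simps)
  moreover have "(\<Sum>b\<in>#add_mset b A. 1 / (1 + cmod b)) = 1 / (1 + cmod b) + T"
    by (simp add: T_def)
  ultimately show ?case
    by presburger
qed

lemma Re_cnj_pderiv_le:
  fixes P :: "complex poly" and z :: complex
  assumes "cmod z = 1" "P \<noteq> 0" "\<And>b. poly P b = 0 \<Longrightarrow> cmod b \<ge> 1"
  shows "Re (cnj (poly P z) * (z * poly (pderiv P) z))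
    \<le> (cmod (poly P z))\<^sup>2 * (\<Sum>b\<in>#proots P. 1 / (1 + cmod b))"
proof -
  define c where "c = lead_coeff P"
  define R where "R = (\<Prod>b\<in>#proots P. [:-b, 1:])"
  define T where "T = (\<Sum>b\<in>#proots P. 1 / (1 + cmod b))"
  have P: "P = smult c R"
    unfolding c_def R_def by (rule complex_poly_decompose_multiset[symmetric])
  have R: "Re (cnj (poly R z) * (z * poly (pderiv R) z)) \<le> (cmod (poly R z))\<^sup>2 * T"
    unfolding R_def T_def using assms by (intro Re_cnj_pderiv_prod_mset_le) auto
  have "cnj (poly P z) * (z * poly (pderiv P) z)
      = (c * cnj c) * (cnj (poly R z) * (z * poly (pderiv R) z))"
    by (simp add: P pderiv_smult)
  also have "\<dots> = of_real ((cmod c)\<^sup>2) * (cnj (poly R z) * (z * poly (pderiv R) z))"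
    by (simp only: complex_norm_square)
  finally have "Re (cnj (poly P z) * (z * poly (pderiv P) z))
      = (cmod c)\<^sup>2 * Re (cnj (poly R z) * (z * poly (pderiv R) z))"
    by (simp only: Re_of_real_mult)
  also have "\<dots> \<le> (cmod c)\<^sup>2 * ((cmod (poly R z))\<^sup>2 * T)"
    by (intro mult_left_mono R) auto
  also have "\<dots> = (cmod (poly P z))\<^sup>2 * T"
    by (simp add: P norm_mult power_mult_distrib)
  finally show ?thesis
    unfolding T_def .
qed

text \<open>Expanding the right-hand square leaves a cross term that \<open>Re_cnj_pderiv_le\<close>
  controls. As there are \<open>n\<close> zeros with multiplicity, the last bracket on the left is
  the sum \<open>S\<close> of \<open>(|b| - 1) / (|b| + 1)\<close>.\<close>

lemma cmod_reciprocal_deriv_sq_ge: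
  fixes P :: "complex poly" and z :: complex
  assumes "cmod z = 1" "P \<noteq> 0" "\<And>b. poly P b = 0 \<Longrightarrow> cmod b \<ge> 1"
  defines "n \<equiv> degree P"
  shows "(cmod (poly (pderiv P) z))\<^sup>2
      + real n * (cmod (poly P z))\<^sup>2 * (real n - 2 * (\<Sum>b\<in>#proots P. 1 / (1 + cmod b)))
    \<le> (cmod (of_nat n * poly P z - z * poly (pderiv P) z))\<^sup>2"
proof -
  define p where "p = poly P z"
  define w where "w = z * poly (pderiv P) z"
  have w: "cmod (poly (pderiv P) z) = cmod w"
    using assms(1) by (simp add: w_def norm_mult)
  have "(cmod (of_nat n * p - w))\<^sup>2
      = (real n)\<^sup>2 * (cmod p)\<^sup>2 + (cmod w)\<^sup>2 - 2 * real n * Re (cnj p * w)"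
    unfolding cmod_power2 by (simp add: power2_eq_square algebra_simps)
  moreover have "2 * real n * Re (cnj p * w)
      \<le> 2 * real n * ((cmod p)\<^sup>2 * (\<Sum>b\<in>#proots P. 1 / (1 + cmod b)))"
    unfolding p_def w_def by (intro mult_left_mono Re_cnj_pderiv_le assms) auto
  ultimately show ?thesis
    unfolding w unfolding p_def[symmetric] w_def[symmetric]
    by (simp add: power2_eq_square algebra_simps)
qed

lemma two_sum_inverse_le_degree:
  fixes P :: "complex poly"
  assumes "P \<noteq> 0" "\<And>b. poly P b = 0 \<Longrightarrow> cmod b \<ge> 1"
  shows "2 * (\<Sum>b\<in>#proots P. 1 / (1 + cmod b)) \<le> real (degree P)"
proof -
  have "(\<Sum>b\<in>#proots P. 1 / (1 + cmod b)) \<le> (\<Sum>b\<in>#proots P. 1 / 2)"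
    using assms by (intro sum_mset_mono frac_le) auto
  thus ?thesis
    by (simp add: size_proots_complex)
qed

lemma cmod_pderiv_le_reciprocal:
  fixes P :: "complex poly" and z :: complex
  assumes "cmod z = 1" "P \<noteq> 0" "\<And>b. poly P b = 0 \<Longrightarrow> cmod b \<ge> 1"
  shows "cmod (poly (pderiv P) z) \<le> cmod (of_nat (degree P) * poly P z - z * poly (pderiv P) z)"
proof (rule power2_le_imp_le)
  have "0 \<le> real (degree P) * (cmod (poly P z))\<^sup>2
      * (real (degree P) - 2 * (\<Sum>b\<in>#proots P. 1 / (1 + cmod b)))"
    using two_sum_inverse_le_degree[OF assms(2,3)] by simp
  thus "(cmod (poly (pderiv P) z))\<^sup>2
      \<le> (cmod (of_nat (degree P) * poly P z - z * poly (pderiv P) z))\<^sup>2"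
    using cmod_reciprocal_deriv_sq_ge[OF assms] by linarith
qed simp

section \<open>Maximum modulus and the bound for the sum of the two derivatives\<close>

lemma cmod_poly_le_max_mod:
  assumes "cmod z = r"
  shows "cmod (poly P z) \<le> max_mod P r"
proof -
  have "compact ((\<lambda>z. cmod (poly P z)) ` sphere 0 r)"
    by (intro compact_continuous_image continuous_intros compact_sphere)
  hence "bdd_above ((\<lambda>z. cmod (poly P z)) ` sphere 0 r)"
    by (intro bounded_imp_bdd_above compact_imp_bounded)
  thus ?thesis
    unfolding max_mod_def using assms by (intro cSUP_upper) auto
qed

lemma cmod_poly_le_max_mod_cball:
  assumes "cmod z \<le> r"
  shows "cmod (poly P z) \<le> max_mod P r"
proof (rule maximum_modulus_frontier[where f = "poly P" and S = "cball 0 r"])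
  show "poly P holomorphic_on interior (cball 0 r)"
    by (intro holomorphic_intros)
  show "continuous_on (closure (cball 0 r)) (poly P)"
    by (intro continuous_intros)
  show "cmod (poly P w) \<le> max_mod P r" if "w \<in> frontier (cball 0 r)" for w
    using that by (intro cmod_poly_le_max_mod) (auto simp: frontier_cball)
qed (use assms in auto)

lemma max_mod_pos:
  assumes "P \<noteq> 0" "r > 0"
  shows "max_mod P r > 0"
proof (rule ccontr)
  assume "\<not> max_mod P r > 0"
  hence "poly P w = 0" if "w \<in> cball 0 r" for w
    using order_trans[OF norm_ge_zero cmod_poly_le_max_mod_cball[of w r P]]
      cmod_poly_le_max_mod_cball[of w r P] that by simp
  hence "cball 0 r \<subseteq> {w. poly P w = 0}"
    by auto
  hence "finite (cball (0::complex) r)"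
    using poly_roots_finite[OF assms(1)] finite_subset by blast
  thus False
    using assms(2) countable_finite uncountable_cball by blast
qed

text \<open>Subtracting a constant of modulus greater than \<open>M\<close> from \<open>P\<close>
  keeps the derivative and expels all zeros from the unit disc, so
  \<open>cmod_pderiv_le_reciprocal\<close> applies whatever the zeros of \<open>P\<close>
  are.\<close>

lemma cmod_pderiv_add_reciprocal_le:
  fixes P :: "complex poly" and z :: complex
  assumes "degree P \<ge> 1" "cmod z = 1"
  defines "n \<equiv> degree P"
  shows "cmod (poly (pderiv P) z) + cmod (of_nat n * poly P z - z * poly (pderiv P) z)
    \<le> real n * max_mod P 1"
proof -
  define M where "M = max_mod P 1"
  define w where "w = of_nat n * poly P z - z * poly (pderiv P) z"
  have n: "n \<ge> 1"
    using assms by simp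
  have Mpos: "M > 0"
    unfolding M_def using assms(1) by (intro max_mod_pos) auto
  \<comment> \<open>\<open>u\<close> is the direction of \<open>w\<close>: subtracting
    \<open>n * s * u\<close> then moves \<open>w\<close> along its own line through 0, and the new
    modulus is \<open>\<bar>cmod w - n * s\<bar>\<close>.\<close>
  obtain u where u: "cmod u = 1" "w = of_real (cmod w) * u"
  proof (cases "w = 0")
    case True
    thus ?thesis by (intro that[of 1]) auto
  next
    case False
    thus ?thesis by (intro that[of "w / of_real (cmod w)"]) (auto simp: norm_divide)
  qed
  have key: "cmod (poly (pderiv P) z) \<le> \<bar>cmod w - real n * s\<bar>" if s: "s > M" for s
  proof -
    define F where "F = P - [:of_real s * u:]"
    have degF: "degree F = n"
      unfolding F_def n_def diff_conv_add_uminus using assms(1)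
      by (intro degree_add_eq_left) simp
    hence F0: "F \<noteq> 0"
      using n by auto
    have roots: "cmod b \<ge> 1" if "poly F b = 0" for b
    proof (rule ccontr)
      assume "\<not> cmod b \<ge> 1"
      hence "cmod (poly P b) \<le> M"
        unfolding M_def by (intro cmod_poly_le_max_mod_cball) auto
      moreover have "poly P b = of_real s * u"
        using that by (simp add: F_def)
      ultimately show False
        using s Mpos u(1) by (simp add: norm_mult)
    qed
    have "pderiv F = pderiv P"
      by (simp add: F_def pderiv_diff pderiv_pCons)
    hence "cmod (poly (pderiv P) z) \<le> cmod (of_nat n * poly F z - z * poly (pderiv P) z)"
      using cmod_pderiv_le_reciprocal[OF assms(2) F0 roots] degF by simp
    also have "of_nat n * poly F z - z * poly (pderiv P) z = w - of_nat n * (of_real s * u)"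
      by (simp add: F_def w_def algebra_simps)
    also have "\<dots> = of_real (cmod w - real n * s) * u"
      by (subst u(2)) (simp add: algebra_simps)
    also have "cmod \<dots> = \<bar>cmod w - real n * s\<bar>"
      by (simp only: norm_mult norm_of_real u(1) mult_1_right)
    finally show ?thesis .
  qed
  \<comment> \<open>This fixes the sign inside the absolute value of \<open>key\<close>. Otherwise
    \<open>s = cmod w / n\<close> would be admissible and make the right side of \<open>key\<close>
    vanish, forcing \<open>P'(z) = 0\<close> and
    \<open>cmod w = n * cmod (poly P z)\<close>.\<close>
  have w_le: "cmod w \<le> real n * M"
  proof (rule ccontr)
    assume "\<not> cmod w \<le> real n * M"
    hence "cmod w / real n > M"
      using n by (simp add: field_simps)
    from key[OF this] have "poly (pderiv P) z = 0"
      using n by simp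
    hence "cmod w = real n * cmod (poly P z)"
      by (simp add: w_def norm_mult)
    also have "\<dots> \<le> real n * M"
      unfolding M_def by (intro mult_left_mono cmod_poly_le_max_mod assms) auto
    finally show False
      using \<open>\<not> cmod w \<le> real n * M\<close> by simp
  qed
  have "(cmod (poly (pderiv P) z) + cmod w) / real n \<le> M"
  \<comment> \<open>\<open>key\<close> holds only for \<open>s > M\<close>, so the bound at
    \<open>M\<close> is reached as a limit.\<close>
  proof (rule dense_ge)
    fix s assume s: "s > M"
    have "cmod w \<le> real n * s"
      using w_le s mult_left_mono[of M s "real n"] by linarith
    thus "(cmod (poly (pderiv P) z) + cmod w) / real n \<le> s"
      using key[OF s] n by (simp add: field_simps)
  qed
  thus ?thesis
    using n unfolding w_def M_def by (simp add: field_simps)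
qed

section \<open>Lower bound for the sum over the zeros\<close>

text \<open>With \<open>t\<close> and \<open>u\<close> the two fractions on the right, the left side
  is \<open>(t + u) / (1 + t * u)\<close>, the addition law of tanh, and
  \<open>t * u \<ge> 0\<close>.\<close>

lemma ratio_mult_le_add:
  fixes a b x y :: real
  assumes "0 < a" "a \<le> b" "0 < x" "x \<le> y"
  shows "(b * y - a * x) / (b * y + a * x) \<le> (b - a) / (b + a) + (y - x) / (y + x)"
proof -
  have "(b * y - a * x) / (b * y + a * x) = 2 * (b * y - a * x) / (2 * (b * y + a * x))"
    by (rule mult_divide_mult_cancel_left[symmetric]) simp
  also have "2 * (b * y - a * x) = (b - a) * (y + x) + (b + a) * (y - x)"
    by (simp add: algebra_simps)
  also have "2 * (b * y + a * x) = (b + a) * (y + x) + (b - a) * (y - x)"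
    by (simp add: algebra_simps)
  also have "((b - a) * (y + x) + (b + a) * (y - x)) / ((b + a) * (y + x) + (b - a) * (y - x))
      \<le> ((b - a) * (y + x) + (b + a) * (y - x)) / ((b + a) * (y + x))"
    using assms by (intro divide_left_mono) (auto intro!: mult_pos_pos add_pos_nonneg)
  also have "\<dots> = (b - a) / (b + a) + (y - x) / (y + x)"
    using assms by (simp add: add_frac_eq)
  finally show ?thesis .
qed

text \<open>Subadditivity splits the ratio of products into one fraction per zero. Lowering each
  denominator from \<open>cmod b + k\<close> to \<open>cmod b + 1\<close> makes the fraction affine
  in \<open>1 / (1 + cmod b)\<close>.\<close>

lemma size_minus_sum_inverse_ge:
  fixes A :: "complex multiset" and k :: real
  assumes "k \<ge> 1" "\<And>b. b \<in># A \<Longrightarrow> cmod b \<ge> k"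
  shows "2 / (k + 1) * (real (size A) * (k - 1) / 2 +
      ((\<Prod>b\<in>#A. cmod b) - k ^ size A) / ((\<Prod>b\<in>#A. cmod b) + k ^ size A))
    \<le> real (size A) - 2 * (\<Sum>b\<in>#A. 1 / (1 + cmod b))"
proof -
  \<comment> \<open>The first conjunct is carried along because \<open>ratio_mult_le_add\<close>
    requires it in the induction step.\<close>
  have "k ^ size A \<le> (\<Prod>b\<in>#A. cmod b) \<and>
    ((\<Prod>b\<in>#A. cmod b) - k ^ size A) / ((\<Prod>b\<in>#A. cmod b) + k ^ size A)
      \<le> (\<Sum>b\<in>#A. (cmod b - k) / (cmod b + 1))"
    using assms(2)
  proof (induction A)
    case empty
    thus ?case by simp
  next
    case (add b A)
    define X where "X = (\<Prod>b\<in>#A. cmod b)"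
    define T where "T = (\<Sum>b\<in>#A. (cmod b - k) / (cmod b + 1))"
    have IH: "k ^ size A \<le> X" "(X - k ^ size A) / (X + k ^ size A) \<le> T"
      using add.IH add.prems unfolding X_def T_def by simp_all
    have b: "cmod b \<ge> k"
      using add.prems by simp
    have "(cmod b * X - k * k ^ size A) / (cmod b * X + k * k ^ size A)
        \<le> (cmod b - k) / (cmod b + k) + (X - k ^ size A) / (X + k ^ size A)"
      using assms(1) b IH by (intro ratio_mult_le_add) auto
    also have "(cmod b - k) / (cmod b + k) \<le> (cmod b - k) / (cmod b + 1)"
      using assms(1) b by (intro divide_left_mono) (auto intro!: mult_pos_pos)
    finally have "(cmod b * X - k * k ^ size A) / (cmod b * X + k * k ^ size A)
        \<le> (cmod b - k) / (cmod b + 1) + T"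
      using IH(2) by simp
    moreover have "k * k ^ size A \<le> cmod b * X"
      using assms(1) b IH(1) by (intro mult_mono) auto
    ultimately show ?case
      by (simp add: X_def T_def)
  qed
  hence "2 / (k + 1) * (real (size A) * (k - 1) / 2 +
      ((\<Prod>b\<in>#A. cmod b) - k ^ size A) / ((\<Prod>b\<in>#A. cmod b) + k ^ size A))
    \<le> 2 / (k + 1) * (real (size A) * (k - 1) / 2 + (\<Sum>b\<in>#A. (cmod b - k) / (cmod b + 1)))"
    using assms(1) by (intro mult_left_mono add_left_mono) auto
  also have "(\<Sum>b\<in>#A. (cmod b - k) / (cmod b + 1))
      = real (size A) - (k + 1) * (\<Sum>b\<in>#A. 1 / (1 + cmod b))"
  proof (induction A)
    case (add b A)
    have "1 + cmod b > 0"
      by (simp add: add_pos_nonneg)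
    hence "(cmod b - k) / (cmod b + 1) = 1 - (k + 1) * (1 / (1 + cmod b))"
      by (simp add: field_simps)
    thus ?case
      using add.IH by (simp add: algebra_simps)
  qed simp
  also have "2 / (k + 1) * (real (size A) * (k - 1) / 2 +
      (real (size A) - (k + 1) * (\<Sum>b\<in>#A. 1 / (1 + cmod b))))
    = real (size A) - 2 * (\<Sum>b\<in>#A. 1 / (1 + cmod b))"
    using assms(1) by (simp add: field_simps)
  finally show ?thesis .
qed

text \<open>Vieta's formula; it lets the quotient of coefficients in the theorem be read as a
  quotient in the product of the moduli of the zeros.\<close>

lemma cmod_coeff_0_eq_prod_proots:
  fixes P :: "complex poly"
  shows "cmod (coeff P 0) = cmod (lead_coeff P) * (\<Prod>b\<in>#proots P. cmod b)"
proof -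
  have "poly (\<Prod>b\<in>#A. [:-b, 1:]) 0 = (\<Prod>b\<in>#A. -b)" for A :: "complex multiset"
    by (induction A) auto
  moreover have "cmod (\<Prod>b\<in>#A. -b) = (\<Prod>b\<in>#A. cmod b)" for A :: "complex multiset"
    by (induction A) (auto simp: norm_mult)
  moreover have "coeff P 0 = poly (smult (lead_coeff P) (\<Prod>b\<in>#proots P. [:-b, 1:])) 0"
    by (simp add: complex_poly_decompose_multiset poly_0_coeff_0)
  ultimately show ?thesis
    by (simp add: norm_mult)
qed

theorem corollary3:
  fixes P :: "complex poly" and n :: nat and k :: real and z :: complex
  assumes "n \<ge> 1" and "degree P = n"
    and "k \<ge> 1"
    and "\<And>b. poly P b = 0 \<Longrightarrow> cmod b \<ge> k"
    and "cmod z = 1"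
  shows "cmod (poly (pderiv P) z) \<le>
    1 / 2 * (real n - 2 / (k + 1) *
      (real n * (k - 1) / 2 +
        (cmod (coeff P 0) - k ^ n * cmod (coeff P n)) /
        (cmod (coeff P 0) + k ^ n * cmod (coeff P n))) *
      ((cmod (poly P z))\<^sup>2 / (max_mod P 1)\<^sup>2)) * max_mod P 1"
proof -
  define M where "M = max_mod P 1"
  define p' where "p' = cmod (poly (pderiv P) z)"
  define q' where "q' = cmod (of_nat n * poly P z - z * poly (pderiv P) z)"
  define p where "p = cmod (poly P z)"
  define S where "S = real n - 2 * (\<Sum>b\<in>#proots P. 1 / (1 + cmod b))"
  define K where "K = 2 / (k + 1) * (real n * (k - 1) / 2 +
        (cmod (coeff P 0) - k ^ n * cmod (coeff P n)) /
        (cmod (coeff P 0) + k ^ n * cmod (coeff P n)))"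
  have P0: "P \<noteq> 0"
    using assms(1,2) by auto
  have roots: "cmod b \<ge> 1" if "poly P b = 0" for b
    using assms(3) assms(4)[OF that] by linarith
  have M: "M > 0"
    unfolding M_def by (intro max_mod_pos P0) simp
  define X where "X = (\<Prod>b\<in>#proots P. cmod b)"
  define c where "c = cmod (lead_coeff P)"
  have c: "c \<noteq> 0"
    using P0 by (simp add: c_def)
  have "(cmod (coeff P 0) - k ^ n * cmod (coeff P n)) / (cmod (coeff P 0) + k ^ n * cmod (coeff P n))
      = (c * (X - k ^ n)) / (c * (X + k ^ n))"
    using assms(2) cmod_coeff_0_eq_prod_proots[of P] by (simp add: c_def X_def algebra_simps)
  also have "\<dots> = (X - k ^ n) / (X + k ^ n)"
    using c by simp
  finally have "K = 2 / (k + 1) * (real n * (k - 1) / 2 + (X - k ^ n) / (X + k ^ n))"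
    unfolding K_def by simp
  also have "\<dots> \<le> S"
    using size_minus_sum_inverse_ge[of k "proots P"] assms(2,3,4) P0
    by (simp add: size_proots_complex S_def X_def)
  finally have KS: "K \<le> S" .
  have sum: "p' + q' \<le> real n * M"
    using cmod_pderiv_add_reciprocal_le[of P z] assms(1,2,5)
    by (simp add: p'_def q'_def M_def)
  have sq: "p'\<^sup>2 + real n * p\<^sup>2 * S \<le> q'\<^sup>2"
    using cmod_reciprocal_deriv_sq_ge[OF assms(5) P0 roots] assms(2)
    by (simp add: p'_def q'_def p_def S_def)
  have "p' \<le> q'"
    using cmod_pderiv_le_reciprocal[OF assms(5) P0 roots] assms(2)
    by (simp add: p'_def q'_def)
  have "real n * (p\<^sup>2 * K) \<le> real n * (p\<^sup>2 * S)"
    using KS by (intro mult_left_mono) auto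
  also have "\<dots> \<le> (q' - p') * (q' + p')"
    using sq by (simp add: power2_eq_square algebra_simps)
  \<comment> \<open>Bounding only the factor \<open>q' + p'\<close> is legitimate because
    \<open>q' - p'\<close> is nonnegative; the common factor \<open>n\<close> then cancels.\<close>
  also have "\<dots> \<le> (q' - p') * (real n * M)"
    using sum \<open>p' \<le> q'\<close> by (intro mult_left_mono) auto
  finally have "real n * (p\<^sup>2 * K) \<le> real n * ((q' - p') * M)"
    by (simp add: algebra_simps)
  hence "p\<^sup>2 * K \<le> (q' - p') * M"
    using assms(1) by simp
  hence "p\<^sup>2 * K / M \<le> q' - p'"
    using M by (simp add: field_simps)
  \<comment> \<open>Adding the bounds for \<open>p' - q'\<close> and \<open>p' + q'\<close>
    eliminates \<open>q'\<close>.\<close>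
  hence "2 * p' \<le> real n * M - p\<^sup>2 * K / M"
    using sum by linarith
  also have "\<dots> = (real n - K * (p\<^sup>2 / M\<^sup>2)) * M"
    using M by (simp add: field_simps power2_eq_square)
  finally have "p' \<le> 1 / 2 * (real n - K * (p\<^sup>2 / M\<^sup>2)) * M"
    by simp
  thus ?thesis
    unfolding p'_def p_def K_def M_def .
qed

end
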